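(* Let $n\ge 4$ be an integer with $n\equiv 0$ or $1\pmod 4$. For every $\xi\in\mathcal{D}(\mathcal{S}_n)$, the number $s_\xi^{(n)}$ of unlabelled self-complementary graphs $G$ of order $n$ (isomorphism classes of self-complementary graphs of order $n$) with $|\Gamma(G)|=\xi$ satisfies $$s_\xi^{(n)}=\frac{\xi}{n!}\,|\mathcal{L}_\xi(\mathcal{S}_n)|.$$
   Context: Let $V=\{1,\dots,n\}$ and let $\binom{V}{2}$ be the set of 2-element subsets of $V$; write $ij$ for $\{i,j\}$ with $i<j$. A labelled graph of order $n$ is a pair $G=(V,E)$ with $E\subseteq\binom{V}{2}$; $\overline{G}=(V,\binom{V}{2}\setminus E)$ is its complement. Let $A$ be the symmetric group on $V$. For $\alpha\in A$, $\alpha G$ is the graph on $V$ with edge-set $\{\{\alpha i,\alpha j\}: ij\in E\}$, and $\alpha'$ is the permutation of $\binom{V}{2}$ given by $\alpha'\{i,j\}=\{\alpha i,\alpha j\}$. Two labelled graphs $G,H$ are isomorphic if $H=\alpha G$ for some $\alpha\in A$. $\Gamma(G)=\{\alpha\in A:\alpha G=G\}$ is the automorphism group of $G$. $Z(\alpha')$ denotes the set of all cycles (including cycles of length 1) in the disjoint cycle decomposition of $\alpha'$. $G$ is self-complementary if $\alpha G=\overline{G}$ for some $\alpha\in A$; $\mathcal{S}_n$ is the set of all self-complementary labelled graphs on $V$. Put $A_S=\{\alpha\in A:\exists G\in\mathcal{S}_n,\ \alpha G=\overline{G}\}$. Let $\lambda=\binom{n}{2}$, and for $ij\in\binom{V}{2}$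 ($i<j$) let $p_{ij}=\frac{(2n-i)(i-1)}{2}+(j-i)$ and $w(ij)=2^{\lambda-p_{ij}}$; $w$ is a bijection from $\binom{V}{2}$ onto $\{2^0,2^1,\dots,2^{\lambda-1}\}$. For $\alpha\in A_S$, every cycle $z\in Z(\alpha')$ has even length. Write $z=(i_1j_1,i_2j_2,\dots,i_kj_k)$, starting with the element of $z$ at which $w$ is largest, and let $P_1(z)=\{i_1j_1,i_3j_3,\dots,i_{k-1}j_{k-1}\}$ and $P_2(z)=\{i_2j_2,i_4j_4,\dots,i_kj_k\}$. Put $W_1(z)=\sum_{ij\in P_1(z)}w(ij)$, $W_2(z)=\sum_{ij\in P_2(z)}w(ij)$, and define the polynomials $$U_\alpha^{(n)}(x)=\prod_{z\in Z(\alpha')}\bigl(x^{W_1(z)}+x^{W_2(z)}\bigr),\qquad U^{(n)}(x)=\sum_{\alpha\in A_S}U_\alpha^{(n)}(x).$$ Let $d_L$ be the coefficient of $x^L$ in $U^{(n)}(x)$. Put $\mathcal{D}(\mathcal{S}_n)=\{d_L: L\ge 0,\ d_L\ne 0\}$, and for a positive integer $\xi$ put $\mathcal{L}_\xi(\mathcal{S}_n)=\{L: d_L=\xi\}$. *)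

theory Defs
  imports
    Complex_Main
    "HOL-Library.Ramsey"
    "HOL-Combinatorics.Cycles"
    "HOL-Computational_Algebra.Polynomial"
begin

text \<open>A labelled graph is a pair of a vertex set and a set of 2-element subsets of it;
  \<^term>\<open>nsets V 2\<close> is the set of all 2-element subsets of \<^term>\<open>V\<close>.\<close>

type_synonym graph = "nat set \<times> nat set set"

definition vertices :: "nat \<Rightarrow> nat set" where
  "vertices n = {1..n}"

definition labelled_graphs :: "nat \<Rightarrow> graph set" where
  "labelled_graphs n = {(V, E). V = vertices n \<and> E \<subseteq> nsets V 2}"

definition complement :: "graph \<Rightarrow> graph" where
  "complement G = (fst G, nsets (fst G) 2 - snd G)"

text \<open>Only used for permutations of the vertex set, which therefore stays the same.\<close>

definition relabel :: "(nat \<Rightarrow> nat) \<Rightarrow> graph \<Rightarrow> graph" where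
  "relabel \<alpha> G = (fst G, (\<lambda>e. \<alpha> ` e) ` snd G)"

definition Sym :: "nat \<Rightarrow> (nat \<Rightarrow> nat) set" where
  "Sym n = {\<alpha>. \<alpha> permutes vertices n}"

definition iso_rel :: "nat \<Rightarrow> (graph \<times> graph) set" where
  "iso_rel n = {(G, H). G \<in> labelled_graphs n \<and> H \<in> labelled_graphs n \<and>
                        (\<exists>\<alpha>\<in>Sym n. H = relabel \<alpha> G)}"

definition Aut :: "nat \<Rightarrow> graph \<Rightarrow> (nat \<Rightarrow> nat) set" where
  "Aut n G = {\<alpha> \<in> Sym n. relabel \<alpha> G = G}"

definition self_compl_graphs :: "nat \<Rightarrow> graph set" where
  "self_compl_graphs n = {G \<in> labelled_graphs n. \<exists>\<alpha>\<in>Sym n. relabel \<alpha> G = complement G}"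

definition compl_perms :: "nat \<Rightarrow> (nat \<Rightarrow> nat) set" where
  "compl_perms n = {\<alpha> \<in> Sym n. \<exists>G\<in>self_compl_graphs n. relabel \<alpha> G = complement G}"

text \<open>The induced permutation of the 2-element subsets, extended by the identity as usual for
  \<open>permutes\<close>.\<close>

definition pair_perm :: "nat \<Rightarrow> (nat \<Rightarrow> nat) \<Rightarrow> nat set \<Rightarrow> nat set" where
  "pair_perm n \<alpha> e = (if e \<in> nsets (vertices n) 2 then \<alpha> ` e else e)"

text \<open>The position of \<open>{i, j}\<close>, \<open>i < j\<close>, in the lexicographic order of pairs, counted from 1.
  The division by 2 is exact, and no subtraction truncates for \<open>1 \<le> i < j \<le> n\<close>.\<close>

definition pos :: "nat \<Rightarrow> nat \<Rightarrow> nat \<Rightarrow> nat" where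
  "pos n i j = (2 * n - i) * (i - 1) div 2 + (j - i)"

definition weight :: "nat \<Rightarrow> nat set \<Rightarrow> nat" where
  "weight n e = 2 ^ ((n choose 2) - pos n (Min e) (Max e))"

text \<open>A cycle is represented by the list of its elements in cyclic order, started at its element
  of largest weight. The weights of distinct pairs are distinct, so every cycle (including those of
  length 1) is represented by exactly one list.
  \<^term>\<open>support p e\<close> is the list \<open>[e, p e, p (p e), \<dots>]\<close> up to the first return to \<open>e\<close>.\<close>

definition cycles :: "nat \<Rightarrow> (nat \<Rightarrow> nat) \<Rightarrow> nat set list set" where
  "cycles n \<alpha> = {support (pair_perm n \<alpha>) e | e.
     e \<in> nsets (vertices n) 2 \<and>
     (\<forall>f\<in>set (support (pair_perm n \<alpha>) e). weight n f \<le> weight n e)}"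

text \<open>List positions count from 0, so the odd-numbered entries of a cycle sit at even positions.\<close>

definition P1 :: "nat set list \<Rightarrow> nat set set" where
  "P1 z = {z ! k | k. k < length z \<and> even k}"

definition P2 :: "nat set list \<Rightarrow> nat set set" where
  "P2 z = {z ! k | k. k < length z \<and> odd k}"

definition W1 :: "nat \<Rightarrow> nat set list \<Rightarrow> nat" where
  "W1 n z = (\<Sum>e\<in>P1 z. weight n e)"

definition W2 :: "nat \<Rightarrow> nat set list \<Rightarrow> nat" where
  "W2 n z = (\<Sum>e\<in>P2 z. weight n e)"

definition U_perm :: "nat \<Rightarrow> (nat \<Rightarrow> nat) \<Rightarrow> nat poly" where
  "U_perm n \<alpha> = (\<Prod>z\<in>cycles n \<alpha>. monom 1 (W1 n z) + monom 1 (W2 n z))"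

definition U :: "nat \<Rightarrow> nat poly" where
  "U n = (\<Sum>\<alpha>\<in>compl_perms n. U_perm n \<alpha>)"

definition D_set :: "nat \<Rightarrow> nat set" where
  "D_set n = {coeff (U n) L | L. coeff (U n) L \<noteq> 0}"

definition L_set :: "nat \<Rightarrow> nat \<Rightarrow> nat set" where
  "L_set n \<xi> = {L. coeff (U n) L = \<xi>}"

definition num_unlabelled_self_compl :: "nat \<Rightarrow> nat \<Rightarrow> nat" where
  "num_unlabelled_self_compl n \<xi> =
     card ({G \<in> self_compl_graphs n. card (Aut n G) = \<xi>} // iso_rel n)"

end

theory Submission
  imports Defs "HOL-Library.Nat_Bijection"
begin

text \<open>A permutation maps a graph to its complement iff membership in the edge set alternates along
  each cycle of the induced permutation of pairs. Expanding the product over the cycles therefore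
  gives one monomial for each such graph, whose exponent is the total weight of the edges. The
  weights are distinct powers of 2, so the exponent determines the graph, and its coefficient in
  the sum over all permutations counts those that complement the graph: a coset of the
  automorphism group. Orbit counting turns labelled graphs into isomorphism classes.\<close>

section \<open>The weight of an edge set determines it\<close>

text \<open>The term \<open>(2 * n - i) * (i - 1) div 2\<close> is (n - 1) + ... + (n - i + 1), the
  number of pairs whose smaller element is below \<open>i\<close>. Passing to \<open>Suc i\<close>
  adds the \<open>n - i\<close> pairs with smaller element \<open>i\<close>.\<close>

lemma pos_offset_step:
  assumes "1 \<le> i" "i \<le> n"
  shows "(2 * n - Suc i) * i div 2 = (2 * n - i) * (i - 1) div 2 + (n - i)"
proof -
  \<comment> \<open>This substitution removes the truncated subtractions. The two numerators then
    differ by \<open>2 * d\<close>, so the halving needs no parity argument.\<close>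
  obtain k d where "i = Suc k" "n = Suc k + d"
    using assms by (metis One_nat_def Suc_le_D le_iff_add)
  moreover have "(k + 2 * d) * Suc k = (Suc k + 2 * d) * k + 2 * d"
    by (simp add: algebra_simps)
  moreover have "((Suc k + 2 * d) * k + 2 * d) div 2 = (Suc k + 2 * d) * k div 2 + d"
    by simp
  ultimately show ?thesis
    by (smt (verit) add_diff_cancel_left' add_Suc add_diff_inverse_nat diff_Suc_1 diff_Suc_Suc
        mult_2 add.assoc add.commute not_add_less1)
qed

text \<open>The last pair of row \<open>i\<close>, with \<open>j = n\<close>, is at the offset where
  row \<open>Suc i\<close> begins, and offsets never decrease.\<close>

lemma pos_le_offset:
  assumes "1 \<le> i" "i < i'" "i' \<le> n" "j \<le> n"
  shows "pos n i j \<le> (2 * n - i') * (i' - 1) div 2"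
proof -
  have "Suc i \<le> i'" using assms(2) by simp
  then show ?thesis
    using assms(3)
  proof (induction i' rule: dec_induct)
    case base
    then show ?case
      using pos_offset_step[of i n] assms(1,4) diff_le_mono[of j n i]
      by (simp only: pos_def diff_Suc_1 add_le_cancel_left)
  next
    case (step m)
    have "pos n i j \<le> (2 * n - m) * (m - 1) div 2"
      using step by simp
    also have "\<dots> \<le> (2 * n - Suc m) * (Suc m - 1) div 2"
      using pos_offset_step[of m n] assms(1) step by (metis Suc_leD diff_Suc_1 le_add1 le_trans)
    finally show ?case .
  qed
qed

text \<open>Ensures that the subtraction in the exponent of a weight does not truncate. At
  \<open>i' = n\<close> the row offset equals \<open>n choose 2\<close>.\<close>

lemma pos_le_choose:
  assumes "1 \<le> i" "i < j" "j \<le> n"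
  shows "pos n i j \<le> n choose 2"
  using pos_le_offset[of i n n j] assms by (simp add: choose_two mult_2)

lemma pos_less_pos:
  assumes "1 \<le> i" "i < i'" "i' < j'" "j \<le> n" "j' \<le> n"
  shows "pos n i j < pos n i' j'"
  using pos_le_offset[of i i' n j] assms unfolding pos_def[of n i'] by simp

lemma pos_inject:
  assumes "1 \<le> i" "i < j" "j \<le> n" "1 \<le> i'" "i' < j'" "j' \<le> n"
    and "pos n i j = pos n i' j'"
  shows "i = i' \<and> j = j'"
proof -
  have "i = i'"
    using pos_less_pos[of i i' j' j n] pos_less_pos[of i' i j j' n] assms
    by (metis less_irrefl linorder_neqE_nat)
  then show ?thesis
    using assms by (simp add: pos_def)
qed

lemma finite_nsets_vertices [simp]: "finite (nsets (vertices n) 2)"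
  by (simp add: vertices_def finite_imp_finite_nsets)

text \<open>The exponent is split off from \<open>weight\<close> so that a sum of weights can be
  read as the \<open>set_encode\<close> of a set of exponents.\<close>

definition weight_exp :: "nat \<Rightarrow> nat set \<Rightarrow> nat" where
  "weight_exp n e = (n choose 2) - pos n (Min e) (Max e)"

lemma inj_on_weight_exp: "inj_on (weight_exp n) (nsets (vertices n) 2)"
proof (rule inj_onI)
  fix e f
  assume "e \<in> nsets (vertices n) 2" "f \<in> nsets (vertices n) 2"
    and eq: "weight_exp n e = weight_exp n f"
  then obtain i j i' j' where ef: "e = {i, j}" "f = {i', j'}"
    and b: "1 \<le> i" "i < j" "j \<le> n" "1 \<le> i'" "i' < j'" "j' \<le> n"
    unfolding ordered_nsets_2_eq vertices_def by auto
  have "Min e = i" "Max e = j" "Min f = i'" "Max f = j'"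
    using ef b by auto
  then have "pos n i j = pos n i' j'"
    using eq pos_le_choose[of i j n] pos_le_choose[of i' j' n] b by (simp add: weight_exp_def)
  then show "e = f"
    using pos_inject[of i j n i' j'] b ef by simp
qed

lemma weight_eq_power: "weight n e = 2 ^ weight_exp n e"
  by (simp add: weight_def weight_exp_def)

lemma inj_on_weight: "inj_on (weight n) (nsets (vertices n) 2)"
  using inj_on_weight_exp by (auto simp: inj_on_def weight_eq_power)

text \<open>Uniqueness of binary expansions: the sum is the binary code of the set of exponents, and
  the exponents are distinct.\<close>

lemma inj_on_sum_weight: "inj_on (sum (weight n)) (Pow (nsets (vertices n) 2))"
proof (rule inj_onI)
  fix E F
  assume E: "E \<in> Pow (nsets (vertices n) 2)" and F: "F \<in> Pow (nsets (vertices n) 2)"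
    and eq: "sum (weight n) E = sum (weight n) F"
  have code: "sum (weight n) S = set_encode (weight_exp n ` S)"
    if "S \<subseteq> nsets (vertices n) 2" for S
    using inj_on_subset[OF inj_on_weight_exp that]
    by (simp add: set_encode_def sum.reindex weight_eq_power)
  have "finite E" "finite F"
    using E F finite_subset[OF _ finite_nsets_vertices] by auto
  then have "weight_exp n ` E = weight_exp n ` F"
    using eq E F by (simp add: code set_encode_eq)
  then show "E = F"
    using inj_on_image_eq_iff[OF inj_on_weight_exp] E F by blast
qed

section \<open>Permutations acting on pairs\<close>

lemma image_permutes_nsets:
  assumes "\<alpha> permutes V"
  shows "(\<lambda>e. \<alpha> ` e) ` nsets V k = nsets V k"
proof -
  have sub: "\<beta> ` e \<in> nsets V k" if "\<beta> permutes V" "e \<in> nsets V k" for \<beta> e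
    using that permutes_image[OF that(1)] inj_on_subset[OF permutes_inj[OF that(1)]]
    by (auto simp: nsets_def card_image)
  have "e \<in> (\<lambda>e. \<alpha> ` e) ` nsets V k" if "e \<in> nsets V k" for e
  proof
    show "e = \<alpha> ` inv \<alpha> ` e"
      using permutes_surj[OF assms] by (simp add: image_f_inv_f)
    show "inv \<alpha> ` e \<in> nsets V k"
      using sub permutes_inv[OF assms] that by blast
  qed
  then show ?thesis
    using sub assms by blast
qed

lemma pair_perm_permutes:
  assumes "\<alpha> \<in> Sym n"
  shows "pair_perm n \<alpha> permutes nsets (vertices n) 2"
proof -
  have \<alpha>: "\<alpha> permutes vertices n"
    using assms by (simp add: Sym_def)
  have "bij_betw (pair_perm n \<alpha>) (nsets (vertices n) 2) (nsets (vertices n) 2)"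
  proof (rule bij_betw_imageI)
    show "inj_on (pair_perm n \<alpha>) (nsets (vertices n) 2)"
      using permutes_inj[OF \<alpha>] by (auto simp: inj_on_def pair_perm_def inj_image_eq_iff)
    show "pair_perm n \<alpha> ` nsets (vertices n) 2 = nsets (vertices n) 2"
      using image_permutes_nsets[OF \<alpha>] by (simp add: pair_perm_def)
  qed
  then show ?thesis
    by (rule bij_imp_permutes) (simp add: pair_perm_def)
qed

text \<open>With \<open>p\<close> the induced permutation of pairs, these are the edge sets of the
  graphs that \<alpha> sends to their complements.\<close>

definition swapped_sets :: "('a \<Rightarrow> 'a) \<Rightarrow> 'a set \<Rightarrow> 'a set set" where
  "swapped_sets p X = {E. E \<subseteq> X \<and> p ` E = X - E}"

text \<open>The pointwise form, in which each application of \<open>p\<close> flips membership,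
  allows induction along a cycle.\<close>

lemma swapped_sets_iff:
  assumes "p permutes X"
  shows "E \<in> swapped_sets p X \<longleftrightarrow> E \<subseteq> X \<and> (\<forall>x\<in>X. p x \<in> E \<longleftrightarrow> x \<notin> E)"
proof -
  have "p ` E = X - E \<longleftrightarrow> (\<forall>x\<in>X. p x \<in> E \<longleftrightarrow> x \<notin> E)" if "E \<subseteq> X"
  proof -
    have "p ` E = X - E \<longleftrightarrow> (\<forall>y\<in>X. y \<in> p ` E \<longleftrightarrow> y \<notin> E)"
      using that permutes_image[OF assms] by blast
    also have "\<dots> \<longleftrightarrow> (\<forall>x\<in>X. p x \<in> p ` E \<longleftrightarrow> p x \<notin> E)"
      using permutes_image[OF assms] by (metis imageE imageI)
    also have "\<dots> \<longleftrightarrow> (\<forall>x\<in>X. p x \<in> E \<longleftrightarrow> x \<notin> E)"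
      using permutes_inj[OF assms] by (auto simp: inj_image_mem_iff)
    finally show ?thesis .
  qed
  then show ?thesis
    by (auto simp: swapped_sets_def)
qed

lemma relabel_eq_complement_iff:
  assumes "E \<subseteq> nsets (vertices n) 2"
  shows "relabel \<alpha> (vertices n, E) = complement (vertices n, E) \<longleftrightarrow>
    E \<in> swapped_sets (pair_perm n \<alpha>) (nsets (vertices n) 2)"
proof -
  have "(\<lambda>e. \<alpha> ` e) ` E = pair_perm n \<alpha> ` E"
    using assms by (auto simp: pair_perm_def image_iff)
  then show ?thesis
    using assms by (auto simp: relabel_def complement_def swapped_sets_def)
qed

section \<open>Expanding the product over the cycles\<close>

lemma prod_monom:
  fixes f :: "'a \<Rightarrow> nat"
  assumes "finite A"
  shows "(\<Prod>x\<in>A. monom (1 :: 'b :: comm_semiring_1) (f x)) = monom 1 (sum f A)"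
  using assms by (induction A rule: finite_induct) (auto simp: mult_monom)

section \<open>Cycles of the pair permutation induced by a complementing permutation\<close>

locale complementing =
  fixes n :: nat and \<alpha> :: "nat \<Rightarrow> nat"
  assumes compl_perm: "\<alpha> \<in> compl_perms n"
begin

abbreviation "X \<equiv> nsets (vertices n) 2"
abbreviation "p \<equiv> pair_perm n \<alpha>"

lemma permutes: "p permutes X"
  using compl_perm pair_perm_permutes by (simp add: compl_perms_def)

lemma permutation: "permutation p"
  using permutes permutes_imp_permutation finite_nsets_vertices by blast

lemma swapped_nonempty: "\<exists>E. E \<in> swapped_sets p X"
proof -
  obtain G where "G \<in> labelled_graphs n" "relabel \<alpha> G = complement G"
    using compl_perm by (auto simp: compl_perms_def self_compl_graphs_def)
  then show ?thesis
    using relabel_eq_complement_iff[of "snd G" n \<alpha>] by (auto simp: labelled_graphs_def)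
qed

lemma funpow_in: "x \<in> X \<Longrightarrow> (p ^^ k) x \<in> X"
  by (induction k) (use permutes_in_image[OF permutes] in auto)

lemma swapped_funpow:
  assumes "E \<in> swapped_sets p X" "x \<in> X"
  shows "(p ^^ k) x \<in> E \<longleftrightarrow> (even k \<longleftrightarrow> x \<in> E)"
proof (induction k)
  case (Suc k)
  then show ?case
    using assms funpow_in[of x k] swapped_sets_iff[OF permutes] by auto
qed simp

text \<open>A cycle is recovered from its head, which is its heaviest element; the later arguments
  therefore work with \<open>hd z\<close> only.\<close>

lemma cycleE:
  assumes "z \<in> cycles n \<alpha>"
  obtains "z = support p (hd z)" "hd z \<in> X" "length z = least_power p (hd z)"
    "hd z \<in> set z" "\<And>f. f \<in> set z \<Longrightarrow> weight n f \<le> weight n (hd z)"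
proof -
  obtain e where e: "z = support p e" "e \<in> X" "\<forall>f\<in>set z. weight n f \<le> weight n e"
    using assms by (auto simp: cycles_def)
  \<comment> \<open>Makes the list nonempty, so that its head is the term with exponent 0, namely
    \<open>e\<close>.\<close>
  have "0 < least_power p e"
    using least_power_of_permutation(2)[OF permutation] .
  then have "hd z = e" "hd z \<in> set z"
    using e(1) by (auto simp: hd_map upt_conv_Cons simp del: upt_Suc)
  then show thesis
    using e that by (metis length_map length_upt minus_nat.diff_0)
qed

lemma cycle_nth:
  assumes "z \<in> cycles n \<alpha>" "k < length z"
  shows "z ! k = (p ^^ k) (hd z)"
  using assms(1)
proof (rule cycleE)
  assume "z = support p (hd z)" "length z = least_power p (hd z)"
  then show ?thesis
    using assms(2) by (metis add_0 length_map nth_map nth_upt)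
qed

lemma cycle_funpow_length:
  assumes "z \<in> cycles n \<alpha>"
  shows "(p ^^ length z) (hd z) = hd z"
  using assms least_power_of_permutation(1)[OF permutation] by (metis cycleE)

text \<open>After one full turn the head returns to itself, while an odd number of steps would flip
  its membership in a swapped set.\<close>

lemma cycle_even_length:
  assumes "z \<in> cycles n \<alpha>"
  shows "even (length z)"
proof -
  obtain E where "E \<in> swapped_sets p X"
    using swapped_nonempty by blast
  then show ?thesis
    using swapped_funpow[of E "hd z" "length z"] cycle_funpow_length[OF assms] assms
    by (metis cycleE)
qed

lemma cycle_subset: "z \<in> cycles n \<alpha> \<Longrightarrow> set z \<subseteq> X"
  using cycle_nth funpow_in by (metis cycleE in_set_conv_nth subsetI)

lemma cycle_distinct: "z \<in> cycles n \<alpha> \<Longrightarrow> distinct z"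
  using cycle_of_permutation[OF permutation] by (metis cycleE)

lemma finite_cycles: "finite (cycles n \<alpha>)"
proof (rule finite_subset)
  show "cycles n \<alpha> \<subseteq> support p ` X"
    by (auto simp: cycles_def)
qed simp

lemma support_eq:
  assumes "y \<in> set (support p x)"
  shows "set (support p y) = set (support p x)"
proof -
  have "y \<in> set (support p y)"
    using least_power_of_permutation(2)[OF permutation, of y] by force
  then show ?thesis
    using disjoint_support[OF permutation] assms unfolding disjoint_def by blast
qed

lemma cycle_exists:
  assumes "x \<in> X"
  shows "\<exists>z\<in>cycles n \<alpha>. x \<in> set z"
proof -
  define S where "S = set (support p x)"
  have x: "x \<in> S"
    using least_power_of_permutation(2)[OF permutation, of x] unfolding S_def by force
  \<comment> \<open>The list started at \<open>x\<close> need not be the representative, so its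
    orbit is restarted at an element \<open>e\<close> of maximal weight.\<close>
  then have "Max (weight n ` S) \<in> weight n ` S"
    by (intro Max_in) (auto simp: S_def)
  then obtain e where e: "Max (weight n ` S) = weight n e" "e \<in> S"
    by (rule imageE)
  then have S: "set (support p e) = S"
    using support_eq unfolding S_def by blast
  have "weight n f \<le> weight n e" if "f \<in> S" for f
    using that by (simp add: S_def flip: e(1))
  moreover have "e \<in> X"
    using e(2) funpow_in[OF assms] by (auto simp: S_def)
  ultimately have "support p e \<in> cycles n \<alpha>"
    using S unfolding cycles_def by blast
  then show ?thesis
    using x S by blast
qed

text \<open>Two cycles sharing an element have the same entries. Both heads then have the maximal
  weight, and injectivity of \<open>weight\<close> makes them equal.\<close>

lemma cycle_unique:
  assumes z: "z \<in> cycles n \<alpha>" "x \<in> set z" and z': "z' \<in> cycles n \<alpha>" "x \<in> set z'"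
  shows "z = z'"
proof -
  have S: "set z = set (support p x)" "set z' = set (support p x)"
    using support_eq[of x "hd z"] support_eq[of x "hd z'"] assms by (metis cycleE)+
  have "weight n (hd z) = weight n (hd z')"
    using z(1) z'(1) S by (metis cycleE order_antisym)
  then have "hd z = hd z'"
    using inj_on_weight z(1) z'(1) by (metis cycleE inj_onD)
  then show ?thesis
    using z(1) z'(1) by (metis cycleE)
qed

section \<open>The two alternating halves of a cycle\<close>

lemma P1_Un_P2: "P1 z \<union> P2 z = set z"
  unfolding P1_def P2_def set_conv_nth by blast

lemma P1_Int_P2: "z \<in> cycles n \<alpha> \<Longrightarrow> P1 z \<inter> P2 z = {}"
  using cycle_distinct by (auto simp: P1_def P2_def nth_eq_iff_index_eq)

lemma hd_in_P1:
  assumes "z \<in> cycles n \<alpha>"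
  shows "hd z \<in> P1 z"
proof -
  have "hd z \<in> set z"
    using assms by (rule cycleE)
  then have "z \<noteq> []"
    by auto
  then have "hd z = z ! 0 \<and> 0 < length z \<and> even (0::nat)"
    by (simp add: hd_conv_nth)
  then show ?thesis
    unfolding P1_def by blast
qed

lemma perm_nth:
  assumes "z \<in> cycles n \<alpha>" "k < length z"
  shows "p (z ! k) = z ! (Suc k mod length z)"
proof (cases "Suc k = length z")
  case True
  then show ?thesis
    using assms cycle_funpow_length cycle_nth[of z 0] cycle_nth[of z k]
    by (metis comp_apply funpow.simps(2) funpow_0 length_greater_0_conv length_0_conv
        mod_self not_less_zero)
next
  case False
  then show ?thesis
    using assms cycle_nth[of z "Suc k"] cycle_nth[of z k] by simp
qed

lemma perm_P1:
  assumes "z \<in> cycles n \<alpha>" "x \<in> P1 z"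
  shows "p x \<in> P2 z"
proof -
  obtain k where k: "x = z ! k" "k < length z" "even k"
    using assms(2) by (auto simp: P1_def)
  \<comment> \<open>Parity survives the wrap-around from the last entry to the first because the
    length is even.\<close>
  then have "odd (Suc k mod length z)"
    using cycle_even_length[OF assms(1)] by (simp add: dvd_mod_iff)
  moreover have "Suc k mod length z < length z"
    using k(2) by (intro mod_less_divisor) linarith
  ultimately show ?thesis
    using perm_nth[OF assms(1) k(2)] k(1) unfolding P2_def by blast
qed

lemma perm_P2:
  assumes "z \<in> cycles n \<alpha>" "x \<in> P2 z"
  shows "p x \<in> P1 z"
proof -
  obtain k where k: "x = z ! k" "k < length z" "odd k"
    using assms(2) by (auto simp: P2_def)
  then have "even (Suc k mod length z)"
    using cycle_even_length[OF assms(1)] by (simp add: dvd_mod_iff)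
  moreover have "Suc k mod length z < length z"
    using k(2) by (intro mod_less_divisor) linarith
  ultimately show ?thesis
    using perm_nth[OF assms(1) k(2)] k(1) unfolding P1_def by blast
qed

text \<open>Membership alternates along the cycle, so the head decides it for every entry.\<close>

lemma swapped_Int_cycle:
  assumes "E \<in> swapped_sets p X" "z \<in> cycles n \<alpha>"
  shows "E \<inter> set z = (if hd z \<in> E then P1 z else P2 z)"
proof -
  have "z ! k \<in> E \<longleftrightarrow> (even k \<longleftrightarrow> hd z \<in> E)" if "k < length z" for k
    using swapped_funpow[OF assms(1)] cycle_nth[OF assms(2) that] assms(2) by (metis cycleE)
  then show ?thesis
    unfolding P1_def P2_def set_conv_nth by (cases "hd z \<in> E") auto
qed

text \<open>\<open>S\<close> records the cycles on which the first summand is chosen when the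
  product over all cycles is expanded.\<close>

definition glue :: "nat set list set \<Rightarrow> nat set set" where
  "glue S = (\<Union>z\<in>cycles n \<alpha>. if z \<in> S then P1 z else P2 z)"

lemma half_subset: "(if z \<in> S then P1 z else P2 z) \<subseteq> set z"
  using P1_Un_P2[of z] by auto

lemma glue_iff:
  assumes "z \<in> cycles n \<alpha>" "x \<in> set z"
  shows "x \<in> glue S \<longleftrightarrow> x \<in> (if z \<in> S then P1 z else P2 z)"
proof -
  have "z' = z" if "z' \<in> cycles n \<alpha>" "x \<in> (if z' \<in> S then P1 z' else P2 z')" for z'
    using cycle_unique[OF that(1) _ assms] half_subset that(2) by blast
  then show ?thesis
    using assms(1) unfolding glue_def by blast
qed

lemma glue_subset: "glue S \<subseteq> X"
  unfolding glue_def by (intro UN_least order_trans[OF half_subset] cycle_subset)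

text \<open>The cycles cover \<open>X\<close>, and \<open>p\<close> exchanges the two halves of each
  of them, exactly one of which is chosen.\<close>

lemma glue_swapped: "glue S \<in> swapped_sets p X"
proof -
  have "p x \<in> glue S \<longleftrightarrow> x \<notin> glue S" if "x \<in> X" for x
  proof -
    obtain z where z: "z \<in> cycles n \<alpha>" "x \<in> set z"
      using cycle_exists \<open>x \<in> X\<close> by blast
    then have "p x \<in> set z"
      using perm_P1 perm_P2 P1_Un_P2 by blast
    then show ?thesis
      using z perm_P1[OF z(1)] perm_P2[OF z(1)] P1_Un_P2[of z] P1_Int_P2[OF z(1)]
      by (auto simp: glue_iff[OF z(1)])
  qed
  then show ?thesis
    using glue_subset swapped_sets_iff[OF permutes] by blast
qed

text \<open>The head always lies in the first half, so the choice made on each cycle can be read off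
  from it. Together with \<open>glue_heads\<close> this makes \<open>glue\<close> a bijection from
  sets of cycles to swapped sets.\<close>

lemma hd_in_glue:
  assumes "z \<in> cycles n \<alpha>"
  shows "hd z \<in> glue S \<longleftrightarrow> z \<in> S"
proof -
  have "hd z \<in> set z" "hd z \<notin> P2 z"
    using hd_in_P1[OF assms] P1_Un_P2[of z] P1_Int_P2[OF assms] by blast+
  then show ?thesis
    using glue_iff[OF assms] hd_in_P1[OF assms] by simp
qed

lemma glue_heads:
  assumes "E \<in> swapped_sets p X"
  shows "glue {z \<in> cycles n \<alpha>. hd z \<in> E} = E"
proof -
  have "x \<in> glue {z \<in> cycles n \<alpha>. hd z \<in> E} \<longleftrightarrow> x \<in> E" if "x \<in> X" for x
  proof -
    obtain z where z: "z \<in> cycles n \<alpha>" "x \<in> set z"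
      using cycle_exists \<open>x \<in> X\<close> by blast
    then show ?thesis
      using glue_iff[OF z] swapped_Int_cycle[OF assms z(1)] by auto
  qed
  then show ?thesis
    using glue_subset assms by (auto simp: swapped_sets_def)
qed

text \<open>Distinct cycles are disjoint, so the weight splits over the cycles. The result is the
  exponent of the monomial belonging to \<open>S\<close> in the expanded product.\<close>

lemma sum_weight_glue:
  assumes "S \<subseteq> cycles n \<alpha>"
  shows "sum (weight n) (glue S) = sum (W1 n) S + sum (W2 n) (cycles n \<alpha> - S)"
proof -
  have fin: "finite (P1 z)" "finite (P2 z)" for z
    using P1_Un_P2[of z] by (metis finite_Un finite_set)+
  have "sum (weight n) (glue S) =
      (\<Sum>z\<in>cycles n \<alpha>. sum (weight n) (if z \<in> S then P1 z else P2 z))"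
    unfolding glue_def
  proof (rule sum.UNION_disjoint)
    show "\<forall>z\<in>cycles n \<alpha>. \<forall>z'\<in>cycles n \<alpha>. z \<noteq> z' \<longrightarrow>
        (if z \<in> S then P1 z else P2 z) \<inter> (if z' \<in> S then P1 z' else P2 z') = {}"
      using cycle_unique half_subset by (meson disjoint_iff subsetD)
  qed (use fin finite_cycles in auto)
  also have "\<dots> = (\<Sum>z\<in>cycles n \<alpha>. if z \<in> S then W1 n z else W2 n z)"
    by (intro sum.cong) (auto simp: W1_def W2_def)
  also have "\<dots> = sum (W1 n) S + sum (W2 n) (cycles n \<alpha> - S)"
    using assms finite_cycles
    by (simp add: sum.If_cases Int_absorb1 Diff_eq)
  finally show ?thesis .
qed

lemma U_perm_eq: "U_perm n \<alpha> = (\<Sum>E\<in>swapped_sets p X. monom 1 (sum (weight n) E))"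
proof -
  have "U_perm n \<alpha> = (\<Sum>S\<in>Pow (cycles n \<alpha>).
      (\<Prod>z\<in>S. monom 1 (W1 n z)) * (\<Prod>z\<in>cycles n \<alpha> - S. monom 1 (W2 n z)))"
    unfolding U_perm_def by (rule prod_add[OF finite_cycles])
  also have "\<dots> = (\<Sum>S\<in>Pow (cycles n \<alpha>). monom 1 (sum (weight n) (glue S)))"
  proof (rule sum.cong)
    fix S
    assume "S \<in> Pow (cycles n \<alpha>)"
    then have S: "S \<subseteq> cycles n \<alpha>" "finite S"
      using finite_cycles finite_subset by auto
    show "(\<Prod>z\<in>S. monom (1::nat) (W1 n z)) * (\<Prod>z\<in>cycles n \<alpha> - S. monom 1 (W2 n z)) =
        monom 1 (sum (weight n) (glue S))"
      unfolding prod_monom[OF S(2)] prod_monom[OF finite_Diff[OF finite_cycles]]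
      by (simp add: mult_monom sum_weight_glue[OF S(1)])
  qed simp
  also have "\<dots> = (\<Sum>E\<in>swapped_sets p X. monom 1 (sum (weight n) E))"
    \<comment> \<open>The inverse of \<open>glue\<close> collects the cycles whose heads lie in
      \<open>E\<close>.\<close>
    by (rule sum.reindex_bij_witness[where i = "\<lambda>E. {z \<in> cycles n \<alpha>. hd z \<in> E}" and j = glue])
      (auto simp: hd_in_glue glue_heads glue_swapped)
  finally show ?thesis .
qed

end

section \<open>Coefficients as automorphism counts\<close>

lemma finite_Sym: "finite (Sym n)"
  by (simp add: Sym_def vertices_def finite_permutations)

lemma finite_labelled_graphs: "finite (labelled_graphs n)"
proof (rule finite_subset)
  show "labelled_graphs n \<subseteq> {vertices n} \<times> Pow (nsets (vertices n) 2)"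
    by (auto simp: labelled_graphs_def)
qed simp

lemma relabel_comp: "relabel (\<alpha> \<circ> \<beta>) G = relabel \<alpha> (relabel \<beta> G)"
  by (simp add: relabel_def image_image image_comp)

lemma relabel_id [simp]: "relabel id G = G"
  by (simp add: relabel_def)

lemma Sym_comp: "\<alpha> \<in> Sym n \<Longrightarrow> \<beta> \<in> Sym n \<Longrightarrow> \<alpha> \<circ> \<beta> \<in> Sym n"
  by (simp add: Sym_def permutes_compose)

lemma Sym_inv: "\<alpha> \<in> Sym n \<Longrightarrow> inv \<alpha> \<in> Sym n"
  by (simp add: Sym_def permutes_inv)

lemma id_Sym: "id \<in> Sym n"
  by (simp add: Sym_def permutes_id)

lemma Sym_inv_comp:
  assumes "\<alpha> \<in> Sym n"
  shows "inv \<alpha> \<circ> \<alpha> = id" "\<alpha> \<circ> inv \<alpha> = id"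
  using assms by (auto simp: Sym_def permutes_inv_o)

lemma relabel_inv:
  assumes "\<alpha> \<in> Sym n"
  shows "relabel (inv \<alpha>) (relabel \<alpha> G) = G" "relabel \<alpha> (relabel (inv \<alpha>) G) = G"
  using Sym_inv_comp[OF assms] by (metis relabel_comp relabel_id)+

lemma relabel_labelled:
  assumes "\<alpha> \<in> Sym n" "G \<in> labelled_graphs n"
  shows "relabel \<alpha> G \<in> labelled_graphs n"
proof -
  obtain E where "G = (vertices n, E)" "E \<subseteq> nsets (vertices n) 2"
    using assms(2) by (auto simp: labelled_graphs_def)
  moreover have "(\<lambda>e. \<alpha> ` e) ` nsets (vertices n) 2 = nsets (vertices n) 2"
    using assms(1) image_permutes_nsets by (simp add: Sym_def)
  ultimately show ?thesis
    unfolding labelled_graphs_def relabel_def by fastforce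
qed

lemma relabel_complement:
  assumes "\<alpha> \<in> Sym n" "G \<in> labelled_graphs n"
  shows "relabel \<alpha> (complement G) = complement (relabel \<alpha> G)"
proof -
  have \<alpha>: "\<alpha> permutes vertices n"
    using assms by (simp add: Sym_def)
  have "inj (\<lambda>e. \<alpha> ` e)"
    using permutes_inj[OF \<alpha>] by (auto simp: inj_on_def inj_image_eq_iff)
  then show ?thesis
    using assms image_permutes_nsets[OF \<alpha>, of 2]
    by (auto simp: relabel_def complement_def labelled_graphs_def image_set_diff)
qed

text \<open>The permutations that agree with \<beta> on \<open>G\<close> form the left coset of
  \<open>Aut n G\<close> by \<beta>.\<close>

lemma card_transporters:
  assumes "\<beta> \<in> Sym n"
  shows "card {\<alpha> \<in> Sym n. relabel \<alpha> G = relabel \<beta> G} = card (Aut n G)"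
proof (rule bij_betw_same_card, rule bij_betw_byWitness[where f' = "\<lambda>\<alpha>. \<beta> \<circ> \<alpha>"])
  show "(\<lambda>\<alpha>. inv \<beta> \<circ> \<alpha>) ` {\<alpha> \<in> Sym n. relabel \<alpha> G = relabel \<beta> G} \<subseteq> Aut n G"
    using assms by (auto simp: Aut_def relabel_comp Sym_comp Sym_inv relabel_inv[OF assms])
  show "(\<lambda>\<alpha>. \<beta> \<circ> \<alpha>) ` Aut n G \<subseteq> {\<alpha> \<in> Sym n. relabel \<alpha> G = relabel \<beta> G}"
    using assms by (auto simp: Aut_def relabel_comp Sym_comp)
qed (use Sym_inv_comp[OF assms] in \<open>auto simp flip: comp_assoc\<close>)

text \<open>Conjugation by \<beta> matches the two automorphism groups.\<close>

lemma card_Aut_relabel: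
  assumes "\<beta> \<in> Sym n"
  shows "card (Aut n (relabel \<beta> G)) = card (Aut n G)"
proof (rule bij_betw_same_card,
    rule bij_betw_byWitness[where f' = "\<lambda>\<alpha>. \<beta> \<circ> \<alpha> \<circ> inv \<beta>"])
  show "(\<lambda>\<alpha>. inv \<beta> \<circ> \<alpha> \<circ> \<beta>) ` Aut n (relabel \<beta> G) \<subseteq> Aut n G"
    using assms by (auto simp: Aut_def relabel_comp Sym_comp Sym_inv relabel_inv[OF assms])
  show "(\<lambda>\<alpha>. \<beta> \<circ> \<alpha> \<circ> inv \<beta>) ` Aut n G \<subseteq> Aut n (relabel \<beta> G)"
    using assms by (auto simp: Aut_def relabel_comp Sym_comp Sym_inv relabel_inv[OF assms])
  have "inv \<beta> (\<beta> x) = x" "\<beta> (inv \<beta> x) = x" for x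
    using assms permutes_inverses by (auto simp: Sym_def)
  then show "\<forall>\<alpha>\<in>Aut n (relabel \<beta> G). \<beta> \<circ> (inv \<beta> \<circ> \<alpha> \<circ> \<beta>) \<circ> inv \<beta> = \<alpha>"
    "\<forall>\<alpha>\<in>Aut n G. inv \<beta> \<circ> (\<beta> \<circ> \<alpha> \<circ> inv \<beta>) \<circ> \<beta> = \<alpha>"
    by (auto simp: fun_eq_iff)
qed

text \<open>Relabelling commutes with complementation, so conjugating a complementing permutation of
  \<open>G\<close> by \<beta> gives one of \<open>relabel \<beta> G\<close>.\<close>

lemma self_compl_relabel:
  assumes "\<beta> \<in> Sym n" "G \<in> self_compl_graphs n"
  shows "relabel \<beta> G \<in> self_compl_graphs n"
proof -
  obtain \<alpha> where \<alpha>: "\<alpha> \<in> Sym n" "relabel \<alpha> G = complement G" and G: "G \<in> labelled_graphs n"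
    using assms(2) by (auto simp: self_compl_graphs_def)
  have "relabel (\<beta> \<circ> \<alpha> \<circ> inv \<beta>) (relabel \<beta> G) = complement (relabel \<beta> G)"
    using \<alpha> G assms(1) by (simp add: relabel_comp relabel_inv relabel_complement)
  moreover have "\<beta> \<circ> \<alpha> \<circ> inv \<beta> \<in> Sym n"
    using \<alpha>(1) assms(1) by (intro Sym_comp Sym_inv)
  ultimately show ?thesis
    using relabel_labelled[OF assms(1) G] by (auto simp: self_compl_graphs_def)
qed

text \<open>Each pair of a permutation and one of its swapped sets contributes one monomial, so the
  coefficient counts pairs.\<close>

lemma coeff_U:
  "coeff (U n) L = card {(\<alpha>, E). \<alpha> \<in> compl_perms n \<and>
     E \<in> swapped_sets (pair_perm n \<alpha>) (nsets (vertices n) 2) \<and> sum (weight n) E = L}"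
proof -
  let ?X = "nsets (vertices n) 2"
  have fin: "finite (compl_perms n)" "finite (swapped_sets q ?X)" for q
    using finite_Sym by (auto simp: compl_perms_def swapped_sets_def)
  have "coeff (U n) L = (\<Sum>\<alpha>\<in>compl_perms n. \<Sum>E\<in>swapped_sets (pair_perm n \<alpha>) ?X.
      if sum (weight n) E = L then 1 else 0)"
    unfolding U_def coeff_sum
    by (intro sum.cong refl) (simp add: coeff_sum complementing.U_perm_eq complementing_def del: One_nat_def)
  also have "\<dots> = (\<Sum>\<alpha>\<in>compl_perms n.
      card {E \<in> swapped_sets (pair_perm n \<alpha>) ?X. sum (weight n) E = L})"
    by (intro sum.cong refl) (simp add: fin flip: sum.inter_filter)
  also have "\<dots> = card (SIGMA \<alpha>:compl_perms n.
      {E \<in> swapped_sets (pair_perm n \<alpha>) ?X. sum (weight n) E = L})"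
    by (rule card_SigmaI[symmetric]) (simp_all add: fin)
  also have "\<dots> = card {(\<alpha>, E). \<alpha> \<in> compl_perms n \<and>
     E \<in> swapped_sets (pair_perm n \<alpha>) ?X \<and> sum (weight n) E = L}"
    by (rule arg_cong[where f = card]) auto
  finally show ?thesis .
qed

text \<open>Turns the counted pairs into pairs of a graph and a permutation complementing it. Such a
  permutation lies in \<open>compl_perms n\<close> with that graph as witness.\<close>

lemma complementing_pair_iff:
  "\<alpha> \<in> compl_perms n \<and> E \<in> swapped_sets (pair_perm n \<alpha>) (nsets (vertices n) 2) \<longleftrightarrow>
   \<alpha> \<in> Sym n \<and> (vertices n, E) \<in> self_compl_graphs n \<and>
   relabel \<alpha> (vertices n, E) = complement (vertices n, E)"
proof -
  have "E \<subseteq> nsets (vertices n) 2"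
    if "E \<in> swapped_sets (pair_perm n \<alpha>) (nsets (vertices n) 2)"
    using that by (simp add: swapped_sets_def)
  moreover have "E \<subseteq> nsets (vertices n) 2" if "(vertices n, E) \<in> self_compl_graphs n"
    using that by (simp add: self_compl_graphs_def labelled_graphs_def)
  ultimately show ?thesis
    using relabel_eq_complement_iff[of E n \<alpha>]
    by (auto simp: compl_perms_def self_compl_graphs_def labelled_graphs_def)
qed

text \<open>The exponent determines the edge set, so only the permutations complementing this one
  graph are counted. They form a coset of its automorphism group.\<close>

lemma coeff_U_self_compl:
  assumes "(vertices n, E) \<in> self_compl_graphs n"
  shows "coeff (U n) (sum (weight n) E) = card (Aut n (vertices n, E))"
proof -
  have E: "E \<subseteq> nsets (vertices n) 2"
    using assms by (simp add: self_compl_graphs_def labelled_graphs_def)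
  have "F = E" if "F \<in> swapped_sets (pair_perm n \<alpha>) (nsets (vertices n) 2)"
    "sum (weight n) F = sum (weight n) E" for F \<alpha>
    using that E inj_onD[OF inj_on_sum_weight[of n], of F E] by (auto simp: swapped_sets_def)
  then have "{(\<alpha>, F). \<alpha> \<in> compl_perms n \<and>
      F \<in> swapped_sets (pair_perm n \<alpha>) (nsets (vertices n) 2) \<and>
      sum (weight n) F = sum (weight n) E} =
    (\<lambda>\<alpha>. (\<alpha>, E)) ` {\<alpha> \<in> Sym n. relabel \<alpha> (vertices n, E) = complement (vertices n, E)}"
    using complementing_pair_iff assms by fastforce
  then have "coeff (U n) (sum (weight n) E) =
      card {\<alpha> \<in> Sym n. relabel \<alpha> (vertices n, E) = complement (vertices n, E)}"
    by (simp add: coeff_U card_image inj_on_def)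
  also have "\<dots> = card (Aut n (vertices n, E))"
  proof -
    obtain \<beta> where "\<beta> \<in> Sym n" "complement (vertices n, E) = relabel \<beta> (vertices n, E)"
      using assms by (auto simp: self_compl_graphs_def)
    then show ?thesis
      by (simp add: card_transporters)
  qed
  finally show ?thesis .
qed

lemma coeff_U_nonzeroE:
  assumes "coeff (U n) L \<noteq> 0"
  obtains E where "(vertices n, E) \<in> self_compl_graphs n" "L = sum (weight n) E"
proof -
  obtain \<alpha> E where "\<alpha> \<in> compl_perms n" "sum (weight n) E = L"
    "E \<in> swapped_sets (pair_perm n \<alpha>) (nsets (vertices n) 2)"
    using assms unfolding coeff_U card_eq_0_iff by fastforce
  then show thesis
    using complementing_pair_iff that by blast
qed

text \<open>Total edge weight is a bijection between the two sets. It is onto because an exponent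
  with nonzero coefficient is the weight of a self-complementary graph.\<close>

lemma card_L_set:
  assumes "\<xi> \<noteq> 0"
  shows "card (L_set n \<xi>) = card {G \<in> self_compl_graphs n. card (Aut n G) = \<xi>}"
proof -
  let ?T = "{G \<in> self_compl_graphs n. card (Aut n G) = \<xi>}"
  have fst: "G = (vertices n, snd G)" "snd G \<subseteq> nsets (vertices n) 2"
    if "G \<in> self_compl_graphs n" for G
    using that by (auto simp: self_compl_graphs_def labelled_graphs_def)
  have "inj_on (\<lambda>G. sum (weight n) (snd G)) ?T"
  proof (rule inj_onI)
    fix G H
    assume "G \<in> ?T" "H \<in> ?T" "sum (weight n) (snd G) = sum (weight n) (snd H)"
    then show "G = H"
      using fst[of G] fst[of H] inj_onD[OF inj_on_sum_weight[of n], of "snd G" "snd H"] by auto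
  qed
  moreover have "(\<lambda>G. sum (weight n) (snd G)) ` ?T = L_set n \<xi>"
  proof (intro equalityI subsetI)
    fix L
    assume "L \<in> (\<lambda>G. sum (weight n) (snd G)) ` ?T"
    then show "L \<in> L_set n \<xi>"
      using fst coeff_U_self_compl by (fastforce simp: L_set_def)
  next
    fix L
    assume "L \<in> L_set n \<xi>"
    then have L: "coeff (U n) L = \<xi>"
      by (simp add: L_set_def)
    then obtain E where "(vertices n, E) \<in> self_compl_graphs n" "L = sum (weight n) E"
      using assms by (metis coeff_U_nonzeroE)
    then show "L \<in> (\<lambda>G. sum (weight n) (snd G)) ` ?T"
      using L coeff_U_self_compl by (intro image_eqI[of _ _ "(vertices n, E)"]) auto
  qed
  ultimately show ?thesis
    using card_image[of "\<lambda>G. sum (weight n) (snd G)" ?T] by simp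
qed

section \<open>Counting isomorphism classes\<close>

lemma equiv_iso_rel: "equiv (labelled_graphs n) (iso_rel n)"
proof (rule equivI)
  show "iso_rel n \<subseteq> labelled_graphs n \<times> labelled_graphs n"
    by (auto simp: iso_rel_def)
  show "refl_on (labelled_graphs n) (iso_rel n)"
    using id_Sym by (auto simp: refl_on_def iso_rel_def intro!: bexI[of _ id])
  show "sym (iso_rel n)"
  proof (rule symI)
    fix G H
    assume "(G, H) \<in> iso_rel n"
    then obtain \<alpha> where "\<alpha> \<in> Sym n" "H = relabel \<alpha> G"
      and GH: "G \<in> labelled_graphs n" "H \<in> labelled_graphs n"
      unfolding iso_rel_def by blast
    then have "inv \<alpha> \<in> Sym n" "G = relabel (inv \<alpha>) H"
      by (simp_all add: Sym_inv relabel_inv)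
    then show "(H, G) \<in> iso_rel n"
      using GH unfolding iso_rel_def by blast
  qed
  show "trans (iso_rel n)"
  proof (rule transI)
    fix G H K
    assume "(G, H) \<in> iso_rel n" "(H, K) \<in> iso_rel n"
    then obtain \<alpha> \<beta> where "\<alpha> \<in> Sym n" "H = relabel \<alpha> G" "\<beta> \<in> Sym n" "K = relabel \<beta> H"
      and GK: "G \<in> labelled_graphs n" "K \<in> labelled_graphs n"
      unfolding iso_rel_def by blast
    then have "\<beta> \<circ> \<alpha> \<in> Sym n" "K = relabel (\<beta> \<circ> \<alpha>) G"
      by (simp_all add: Sym_comp relabel_comp)
    then show "(G, K) \<in> iso_rel n"
      using GK unfolding iso_rel_def by blast
  qed
qed

lemma iso_class_eq:
  assumes "G \<in> labelled_graphs n"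
  shows "iso_rel n `` {G} = (\<lambda>\<alpha>. relabel \<alpha> G) ` Sym n"
  using assms relabel_labelled[OF _ assms] unfolding iso_rel_def by blast

text \<open>Orbit-stabilizer: \<open>Sym n\<close> is partitioned according to the image of
  \<open>G\<close>, and every part has the size of the automorphism group.\<close>

lemma card_iso_class:
  assumes "G \<in> labelled_graphs n"
  shows "card (iso_rel n `` {G}) * card (Aut n G) = fact n"
proof -
  let ?O = "(\<lambda>\<alpha>. relabel \<alpha> G) ` Sym n"
  have "fact n = card (Sym n)"
    by (simp add: Sym_def vertices_def card_permutations)
  also have "\<dots> = (\<Sum>H\<in>?O. card {\<alpha> \<in> Sym n. relabel \<alpha> G = H})"
    unfolding card_eq_sum by (rule sum.image_gen[OF finite_Sym])
  also have "\<dots> = (\<Sum>H\<in>?O. card (Aut n G))"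
    by (intro sum.cong) (auto simp: card_transporters)
  also have "\<dots> = card (iso_rel n `` {G}) * card (Aut n G)"
    by (simp add: iso_class_eq[OF assms])
  finally show ?thesis ..
qed

text \<open>The graphs with group order \<xi> split into isomorphism classes, each of size
  n!/\<xi>.\<close>

lemma card_num_unlabelled:
  assumes "\<xi> \<noteq> 0"
  shows "\<xi> * card {G \<in> self_compl_graphs n. card (Aut n G) = \<xi>} =
    fact n * num_unlabelled_self_compl n \<xi>"
proof -
  let ?T = "{G \<in> self_compl_graphs n. card (Aut n G) = \<xi>}"
  let ?C = "?T // iso_rel n"
  have T: "?T \<subseteq> labelled_graphs n"
    by (auto simp: self_compl_graphs_def)
  have rep: "\<exists>G\<in>?T. c = iso_rel n `` {G} \<and> G \<in> labelled_graphs n" if "c \<in> ?C" for c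
    using that T by (auto elim!: quotientE)
  \<comment> \<open>Classes are formed among all labelled graphs. They stay inside \<open>?T\<close>
    because self-complementarity and the group order are invariant under relabelling.\<close>
  have Union: "\<Union>?C = ?T"
  proof (intro equalityI subsetI)
    fix H
    assume "H \<in> \<Union>?C"
    then obtain G where "G \<in> ?T" "H \<in> iso_rel n `` {G}"
      using rep by blast
    then obtain \<alpha> where "G \<in> ?T" "\<alpha> \<in> Sym n" "H = relabel \<alpha> G"
      by (auto simp: iso_rel_def)
    then show "H \<in> ?T"
      using self_compl_relabel card_Aut_relabel by auto
  next
    fix G
    assume G: "G \<in> ?T"
    then have "G \<in> iso_rel n `` {G}"
      using equiv_class_self[OF equiv_iso_rel] T by blast
    then show "G \<in> \<Union>?C"
      using quotientI[OF G, of "iso_rel n"] by blast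
  qed
  have finT: "finite ?T"
    using T finite_labelled_graphs by (rule finite_subset)
  have "fact n div \<xi> * card ?C = card (\<Union>?C)"
  proof (rule card_partition)
    show "finite ?C"
      using finT by (simp add: quotient_def)
    show "finite (\<Union>?C)"
      using finT Union by simp
    show "card c = fact n div \<xi>" if c: "c \<in> ?C" for c
    proof -
      obtain G where G: "G \<in> ?T" "c = iso_rel n `` {G}" "G \<in> labelled_graphs n"
        using rep[OF c] by blast
      then have "card c * \<xi> = fact n"
        using card_iso_class[of G n] by simp
      then show ?thesis
        using assms by (metis nonzero_mult_div_cancel_right)
    qed
    show "c \<inter> d = {}" if "c \<in> ?C" "d \<in> ?C" "c \<noteq> d" for c d
      using quotient_disj[OF equiv_iso_rel, of c n d] that rep[of c] rep[of d]
      by (metis quotientI)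
  qed
  then have eq: "card ?T = fact n div \<xi> * card ?C"
    using Union by simp
  show ?thesis
  \<comment> \<open>A member of \<open>?T\<close> shows that \<xi> divides n!, which makes the
    \<open>div\<close> exact; for empty \<open>?T\<close> both sides are 0.\<close>
  proof (cases "?T = {}")
    case True
    then show ?thesis
      unfolding num_unlabelled_self_compl_def True by simp
  next
    case False
    then obtain G where G: "G \<in> ?T" by blast
    then have "card (iso_rel n `` {G}) * \<xi> = fact n"
      using card_iso_class[of G n] T by auto
    then have "\<xi> dvd fact n"
      by (metis dvd_triv_right)
    then show ?thesis
      unfolding num_unlabelled_self_compl_def eq by (simp flip: mult.assoc)
  qed
qed

theorem theorem12:
  fixes n \<xi> :: nat
  assumes "n \<ge> 4"
    and "n mod 4 = 0 \<or> n mod 4 = 1"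
    and "\<xi> \<in> D_set n"
  shows "real (num_unlabelled_self_compl n \<xi>) = real \<xi> / fact n * real (card (L_set n \<xi>))"
proof -
  \<comment> \<open>\<open>D_set\<close> collects nonzero coefficients only, so both counting lemmas
    apply.\<close>
  have "\<xi> \<noteq> 0"
    using assms(3) by (auto simp: D_set_def)
  then have "real (\<xi> * card (L_set n \<xi>)) = real (fact n * num_unlabelled_self_compl n \<xi>)"
    using card_L_set card_num_unlabelled by simp
  then show ?thesis
    by (simp add: field_simps)
qed

end
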